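(* Consider a finite MDP with state space $\mathcal S$, action space $\mathcal A$, transition kernel $\mathcal T$, discount factor $\gamma\in[0,1)$, regularization parameter $\lambda>0$, known terminal reward $g:\mathcal S\to\mathbb R$, and an unknown time-homogeneous reward function $f:\mathcal S\times\mathcal A\to\mathbb R$. Let $s\in\mathcal S$ be an initial state and $T>0$ an integer horizon. If $f$ can be identified, up to a global additive constant, from observation of the entropy-regularized optimal policies and the resulting transitions up to horizon $T$ with initialization from the state $s$, then there exists $T'\ge T$ such that the MDP has full access at horizon $T'$ from state $s$.
   Context: Finite-horizon entropy-regularized MDP: for a running reward $f$ and terminal reward $g$, set $V^*_T=g$ and, for $t=T-1,\dots,0$, $$Q^*_t(s,a)=f(s,a)+\gamma\sum_{s'}\mathcal T(s'|s,a)V^*_{t+1}(s'),\quad V^*_t(s)=\lambda\log\sum_{a}\exp(Q^*_t(s,a)/\lambda),\quad \pi^*_t(a|s)=\exp\big((Q^*_t(s,a)-V^*_t(s))/\lambda\big).$$ The family $\{\pi^*_t\}_{t=0}^{T-1}$ is the (time-dependent) entropy-regularized optimal policy; note it gives positive probability to every action. Reachability: a pair $(t,s')$ is reachable from $s$ if $s'$ can be reached from $s$ in exactly $t$ steps, i.e. $\mathbb P(S_t=s'|S_0=s)>0$ when actions are drawn at each step from a distribution with full support on $\mathcal A$. Identification: $f$ is identified up to a global constant, from observation up to horizon $T$ with initialization from $s$, if every time-homogeneous reward $\tilde f:\mathcal S\times\mathcal A\to\mathbb R$ whose optimal policy $\tilde\pi^*$ (same $g,\mathcal T,\gamma,\lambda$,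 horizon $T$) satisfies $\tilde\pi^*_t(\cdot|s')=\pi^*_t(\cdot|s')$ for all $t\in\{0,\dots,T-1\}$ and all $s'$ with $(t,s')$ reachable from $s$, is such that $\tilde f-f$ is constant on $\mathcal S\times\mathcal A$. Full access: the MDP has full access at horizon $T'$ from $s$ if, when actions are drawn from a distribution with full support on $\mathcal A$, $\mathbb P(S_{T'-1}=s'|S_0=s)>0$ for all states $s'\in\mathcal S$. *)

theory Defs
  imports "HOL-Probability.Probability_Mass_Function"
begin

text \<open>
  A finite MDP has states \<^typ>\<open>'s::finite\<close>, actions \<^typ>\<open>'a::finite\<close> and transition kernel
  \<open>K :: 's \<Rightarrow> 'a \<Rightarrow> 's pmf\<close>, where \<open>pmf (K s a) s'\<close> is the probability of moving from \<open>s\<close> to \<open>s'\<close>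
  under action \<open>a\<close>.  The discount factor is \<open>\<gamma>\<close>, the regularization parameter is \<open>lam\<close>, the terminal
  reward is \<open>g\<close>, the running reward is \<open>f\<close> and the horizon is \<open>T\<close>.
\<close>

text \<open>
  Backward recursion in the time index.  For \<open>t \<ge> T\<close> the value is \<open>g\<close>; only \<open>t \<le> T\<close> is meaningful.
\<close>

function opt_V ::
  "('s::finite \<Rightarrow> 'a::finite \<Rightarrow> 's pmf) \<Rightarrow> real \<Rightarrow> real \<Rightarrow> ('s \<Rightarrow> real) \<Rightarrow> ('s \<Rightarrow> 'a \<Rightarrow> real)
    \<Rightarrow> nat \<Rightarrow> nat \<Rightarrow> 's \<Rightarrow> real" where
  "opt_V K \<gamma> lam g f T t s =
    (if t < T then
       lam * ln (\<Sum>a\<in>UNIV. exp ((f s a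
         + \<gamma> * (\<Sum>s'\<in>UNIV. pmf (K s a) s' * opt_V K \<gamma> lam g f T (Suc t) s')) / lam))
     else g s)"
  by pat_completeness auto
termination
  by (relation "Wellfounded.measure (\<lambda>(K, \<gamma>, lam, g, f, T, t, s). T - t)") auto

declare opt_V.simps [simp del]

definition opt_Q ::
  "('s::finite \<Rightarrow> 'a::finite \<Rightarrow> 's pmf) \<Rightarrow> real \<Rightarrow> real \<Rightarrow> ('s \<Rightarrow> real) \<Rightarrow> ('s \<Rightarrow> 'a \<Rightarrow> real)
    \<Rightarrow> nat \<Rightarrow> nat \<Rightarrow> 's \<Rightarrow> 'a \<Rightarrow> real" where
  "opt_Q K \<gamma> lam g f T t s a =
    f s a + \<gamma> * (\<Sum>s'\<in>UNIV. pmf (K s a) s' * opt_V K \<gamma> lam g f T (Suc t) s')"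

lemma opt_V_terminal: "opt_V K \<gamma> lam g f T T = g"
  by (rule ext) (simp add: opt_V.simps)

lemma opt_V_step:
  "t < T \<Longrightarrow>
    opt_V K \<gamma> lam g f T t s = lam * ln (\<Sum>a\<in>UNIV. exp (opt_Q K \<gamma> lam g f T t s a / lam))"
  by (subst opt_V.simps) (simp add: opt_Q_def)

definition opt_policy ::
  "('s::finite \<Rightarrow> 'a::finite \<Rightarrow> 's pmf) \<Rightarrow> real \<Rightarrow> real \<Rightarrow> ('s \<Rightarrow> real) \<Rightarrow> ('s \<Rightarrow> 'a \<Rightarrow> real)
    \<Rightarrow> nat \<Rightarrow> nat \<Rightarrow> 's \<Rightarrow> 'a \<Rightarrow> real" where
  "opt_policy K \<gamma> lam g f T t s a =
    exp ((opt_Q K \<gamma> lam g f T t s a - opt_V K \<gamma> lam g f T t s) / lam)"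

lemma opt_policy_pos: "0 < opt_policy K \<gamma> lam g f T t s a"
  by (simp add: opt_policy_def)

lemma sum_opt_policy:
  assumes "lam > 0" "t < T"
  shows "(\<Sum>a\<in>UNIV. opt_policy K \<gamma> lam g f T t s a) = 1"
proof -
  let ?Z = "\<Sum>a\<in>UNIV. exp (opt_Q K \<gamma> lam g f T t s a / lam)"
  have Z: "?Z > 0"
    by (intro sum_pos) auto
  have "opt_policy K \<gamma> lam g f T t s a = exp (opt_Q K \<gamma> lam g f T t s a / lam) / ?Z" for a
    using assms Z by (simp add: opt_policy_def opt_V_step diff_divide_distrib exp_diff)
  then show ?thesis
    using Z by (simp flip: sum_divide_distrib)
qed

text \<open>The law of \<open>S\<^sub>t\<close> given \<open>S\<^sub>0 = s\<close> when the action is drawn from \<open>\<rho>\<close> at each step.\<close>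

primrec state_law ::
  "('s \<Rightarrow> 'a \<Rightarrow> 's pmf) \<Rightarrow> 'a pmf \<Rightarrow> 's \<Rightarrow> nat \<Rightarrow> 's pmf" where
  "state_law K \<rho> s 0 = return_pmf s"
| "state_law K \<rho> s (Suc t) =
    bind_pmf (state_law K \<rho> s t) (\<lambda>x. bind_pmf \<rho> (\<lambda>a. K x a))"

definition reachable_at ::
  "('s::finite \<Rightarrow> 'a::finite \<Rightarrow> 's pmf) \<Rightarrow> 's \<Rightarrow> nat \<Rightarrow> 's \<Rightarrow> bool" where
  "reachable_at K s t s' \<longleftrightarrow>
    (\<exists>\<rho>. set_pmf \<rho> = UNIV \<and> pmf (state_law K \<rho> s t) s' > 0)"

text \<open>\<open>full_access K s T'\<close> concerns the state at time \<open>T' - 1\<close>, so it is meant for \<open>T' \<ge> 1\<close>.\<close>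

definition full_access ::
  "('s::finite \<Rightarrow> 'a::finite \<Rightarrow> 's pmf) \<Rightarrow> 's \<Rightarrow> nat \<Rightarrow> bool" where
  "full_access K s T' \<longleftrightarrow>
    (\<exists>\<rho>. set_pmf \<rho> = UNIV \<and> (\<forall>s'. pmf (state_law K \<rho> s (T' - 1)) s' > 0))"

text \<open>The choice of the full-support action distribution in these two definitions is immaterial.\<close>

lemma set_state_law_cong:
  assumes "set_pmf \<rho> = UNIV" "set_pmf \<rho>' = UNIV"
  shows "set_pmf (state_law K \<rho> s t) = set_pmf (state_law K \<rho>' s t)"
  using assms by (induction t) simp_all

lemma reachable_at_iff:
  assumes "set_pmf \<rho> = UNIV"
  shows "reachable_at K s t s' \<longleftrightarrow> pmf (state_law K \<rho> s t) s' > 0"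
  using assms set_state_law_cong[OF _ assms, of _ K s t]
  unfolding reachable_at_def pmf_positive_iff by blast

lemma full_access_iff:
  assumes "set_pmf \<rho> = UNIV"
  shows "full_access K s T' \<longleftrightarrow> (\<forall>s'. pmf (state_law K \<rho> s (T' - 1)) s' > 0)"
  using assms set_state_law_cong[OF _ assms, of _ K s "T' - 1"]
  unfolding full_access_def pmf_positive_iff by blast

lemma ex_full_support: "\<exists>\<rho> :: 'a::finite pmf. set_pmf \<rho> = UNIV"
  by (rule exI[of _ "pmf_of_set UNIV"]) simp

definition identified_up_to_constant ::
  "('s::finite \<Rightarrow> 'a::finite \<Rightarrow> 's pmf) \<Rightarrow> real \<Rightarrow> real \<Rightarrow> ('s \<Rightarrow> real) \<Rightarrow> ('s \<Rightarrow> 'a \<Rightarrow> real)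
    \<Rightarrow> nat \<Rightarrow> 's \<Rightarrow> bool" where
  "identified_up_to_constant K \<gamma> lam g f T s \<longleftrightarrow>
    (\<forall>f' :: 's \<Rightarrow> 'a \<Rightarrow> real.
      (\<forall>t s'. t < T \<longrightarrow> reachable_at K s t s' \<longrightarrow>
        (\<forall>a. opt_policy K \<gamma> lam g f' T t s' a = opt_policy K \<gamma> lam g f T t s' a))
      \<longrightarrow> (\<exists>c. \<forall>x a. f' x a - f x a = c))"

end

theory Submission
  imports Defs
begin

text \<open>
  Potential-based reward shaping: for any \<open>\<psi>\<close>, replacing \<open>f\<close> by
  \<open>f(x,a) + \<psi>(x) - \<gamma> \<Sum>\<^sub>y K(y|x,a) \<psi>(y)\<close> shifts the optimal values by \<open>\<psi>\<close> and leaves the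
  policy alone, as long as \<open>\<psi>\<close> agrees with the unchanged terminal reward, that is, vanishes on
  the states reachable in exactly \<open>T\<close> steps. If some state is not reachable in exactly \<open>T\<close> steps,
  take \<open>\<psi>\<close> to be the indicator of the unreachable states: since \<open>\<gamma> < 1\<close> the shaped reward does
  not differ from \<open>f\<close> by a constant, so \<open>f\<close> is not identified. Hence full access already holds
  at \<open>T' = T + 1\<close>.
\<close>

definition shaped_reward ::
  "('s::finite \<Rightarrow> 'a \<Rightarrow> 's pmf) \<Rightarrow> real \<Rightarrow> ('s \<Rightarrow> real) \<Rightarrow> ('s \<Rightarrow> 'a \<Rightarrow> real) \<Rightarrow> 's \<Rightarrow> 'a \<Rightarrow> real" where
  "shaped_reward K \<gamma> \<psi> f x a = f x a + \<psi> x - \<gamma> * (\<Sum>y\<in>UNIV. pmf (K x a) y * \<psi> y)"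

lemma reachable_at_Suc:
  assumes "reachable_at K s t x" "y \<in> set_pmf (K x a)"
  shows "reachable_at K s (Suc t) y"
proof -
  obtain \<rho> where \<rho>: "set_pmf \<rho> = UNIV" "x \<in> set_pmf (state_law K \<rho> s t)"
    using assms(1) unfolding reachable_at_def pmf_positive_iff by blast
  then have "y \<in> set_pmf (state_law K \<rho> s (Suc t))"
    using assms(2) by auto
  then show ?thesis
    using \<rho>(1) unfolding reachable_at_def pmf_positive_iff by blast
qed

lemma ex_reachable_at: "\<exists>x. reachable_at K s t x"
proof -
  obtain \<rho> :: "'b pmf" where \<rho>: "set_pmf \<rho> = UNIV"
    using ex_full_support by blast
  have "set_pmf (state_law K \<rho> s t) \<noteq> {}"
    by (rule set_pmf_not_empty)
  then show ?thesis
    using \<rho> unfolding reachable_at_def pmf_positive_iff by blast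
qed

lemma log_sum_exp_shift:
  fixes q :: "'a::finite \<Rightarrow> real"
  assumes "lam > 0"
  shows "lam * ln (\<Sum>a\<in>UNIV. exp ((q a + c) / lam)) = lam * ln (\<Sum>a\<in>UNIV. exp (q a / lam)) + c"
proof -
  have "(\<Sum>a\<in>UNIV. exp (q a / lam)) > 0"
    by (intro sum_pos) auto
  moreover have "(\<Sum>a\<in>UNIV. exp ((q a + c) / lam)) = (\<Sum>a\<in>UNIV. exp (q a / lam)) * exp (c / lam)"
    by (simp add: add_divide_distrib exp_add sum_distrib_right)
  ultimately show ?thesis
    using assms by (simp add: ln_mult field_simps)
qed

text \<open>The expectation subtracted in \<open>shaped_reward\<close> cancels the shift of the
  next-step values, leaving \<open>\<psi> x\<close>. Successors of probability zero drop out of the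
  sum, so the shift is only required on the support of \<open>K x a\<close>.\<close>

lemma opt_Q_shaped:
  assumes "\<And>y. y \<in> set_pmf (K x a) \<Longrightarrow>
    opt_V K \<gamma> lam g (shaped_reward K \<gamma> \<psi> f) T (Suc t) y = opt_V K \<gamma> lam g f T (Suc t) y + \<psi> y"
  shows "opt_Q K \<gamma> lam g (shaped_reward K \<gamma> \<psi> f) T t x a = opt_Q K \<gamma> lam g f T t x a + \<psi> x"
proof -
  have "(\<Sum>y\<in>UNIV. pmf (K x a) y * opt_V K \<gamma> lam g (shaped_reward K \<gamma> \<psi> f) T (Suc t) y) =
      (\<Sum>y\<in>UNIV. pmf (K x a) y * (opt_V K \<gamma> lam g f T (Suc t) y + \<psi> y))"
    by (intro sum.cong refl) (metis assms mult_zero_left set_pmf_iff)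
  then show ?thesis
    by (simp add: opt_Q_def shaped_reward_def distrib_left sum.distrib)
qed

text \<open>Backward induction from \<open>T\<close>: possible successors of a state reachable at
  time \<open>n\<close> are reachable at \<open>Suc n\<close>, so the induction hypothesis covers
  them.\<close>

lemma opt_V_shaped:
  assumes lam: "lam > 0"
    and \<psi>: "\<And>x. reachable_at K s T x \<Longrightarrow> \<psi> x = 0"
    and "t \<le> T" "reachable_at K s t x"
  shows "opt_V K \<gamma> lam g (shaped_reward K \<gamma> \<psi> f) T t x = opt_V K \<gamma> lam g f T t x + \<psi> x"
  using assms(3,4)
proof (induction arbitrary: x rule: inc_induct)
  case base
  then show ?case
    by (simp add: opt_V_terminal \<psi>)
next
  case (step n)
  have "opt_Q K \<gamma> lam g (shaped_reward K \<gamma> \<psi> f) T n x a = opt_Q K \<gamma> lam g f T n x a + \<psi> x" for a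
    by (intro opt_Q_shaped step.IH reachable_at_Suc[OF step.prems])
  then show ?case
    using step.hyps by (simp add: opt_V_step log_sum_exp_shift[OF lam])
qed

lemma opt_policy_shaped:
  assumes "lam > 0"
    and "\<And>x. reachable_at K s T x \<Longrightarrow> \<psi> x = 0"
    and "t < T" "reachable_at K s t x"
  shows "opt_policy K \<gamma> lam g (shaped_reward K \<gamma> \<psi> f) T t x a = opt_policy K \<gamma> lam g f T t x a"
proof -
  note V = opt_V_shaped[OF assms(1,2)]
  have "opt_Q K \<gamma> lam g (shaped_reward K \<gamma> \<psi> f) T t x a = opt_Q K \<gamma> lam g f T t x a + \<psi> x"
    using assms(3) by (intro opt_Q_shaped V) (auto intro: reachable_at_Suc[OF assms(4)])
  moreover have "opt_V K \<gamma> lam g (shaped_reward K \<gamma> \<psi> f) T t x = opt_V K \<gamma> lam g f T t x + \<psi> x"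
    using assms(3,4) by (intro V) auto
  ultimately show ?thesis
    by (simp add: opt_policy_def)
qed

lemma identified_imp_reachable_at:
  assumes "0 \<le> \<gamma>" "\<gamma> < 1" "lam > 0" "identified_up_to_constant K \<gamma> lam g f T s"
  shows "reachable_at K s T x"
proof (rule ccontr)
  assume x: "\<not> reachable_at K s T x"
  define \<psi> :: "_ \<Rightarrow> real" where "\<psi> = (\<lambda>y. if reachable_at K s T y then 0 else 1)"
  obtain z where z: "reachable_at K s T z"
    using ex_reachable_at by blast
  obtain c where c: "shaped_reward K \<gamma> \<psi> f y a - f y a = c" for y a
    using assms(4) opt_policy_shaped[OF assms(3), of K s T \<psi>]
    unfolding identified_up_to_constant_def by (metis \<psi>_def)
  \<comment> \<open>The probability that \<open>a\<close> leads from \<open>y\<close> to a state not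
    reachable at time \<open>T\<close>.\<close>
  define E where "E = (\<lambda>y a. \<Sum>y'\<in>UNIV. pmf (K y a) y' * \<psi> y')"
  have c': "\<psi> y - \<gamma> * E y a = c" for y a
    using c[of y a] by (simp add: shaped_reward_def E_def)
  have E0: "0 \<le> E y a" for y a
    unfolding E_def \<psi>_def by (intro sum_nonneg) auto
  have E1: "E y a \<le> 1" for y a
  proof -
    have "E y a \<le> (\<Sum>y'\<in>UNIV. pmf (K y a) y')"
      unfolding E_def \<psi>_def by (intro sum_mono) auto
    also have "\<dots> = 1"
      by (simp add: sum_pmf_eq_1)
    finally show ?thesis .
  qed
  \<comment> \<open>Any action will do, hence \<open>undefined\<close>. At \<open>z\<close> the
    constant is \<open>- \<gamma> * E z a\<close>, at \<open>x\<close> it is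
    \<open>1 - \<gamma> * E x a\<close>: opposite signs.\<close>
  have "c \<le> 0"
    using c'[of z undefined] z mult_nonneg_nonneg[OF assms(1) E0, of z undefined]
    by (simp add: \<psi>_def)
  moreover have "\<gamma> * E x undefined < 1"
    using mult_left_mono[OF E1 assms(1), of x undefined] assms(2) by simp
  then have "c > 0"
    using c'[of x undefined] x by (simp add: \<psi>_def algebra_simps)
  ultimately show False
    by simp
qed

theorem theorem3:
  fixes K :: "'s::finite \<Rightarrow> 'a::finite \<Rightarrow> 's pmf"
    and \<gamma> lam :: real
    and g :: "'s \<Rightarrow> real"
    and f :: "'s \<Rightarrow> 'a \<Rightarrow> real"
    and s :: 's
    and T :: nat
  assumes "0 \<le> \<gamma>" and "\<gamma> < 1"
    and "lam > 0"
    and "T > 0"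
    and "identified_up_to_constant K \<gamma> lam g f T s"
  shows "\<exists>T'. T' \<ge> T \<and> full_access K s T'"
proof -
  obtain \<rho> :: "'a pmf" where \<rho>: "set_pmf \<rho> = UNIV"
    using ex_full_support by blast
  \<comment> \<open>Access at horizon \<open>Suc T\<close> concerns the state at time
    \<open>T\<close>.\<close>
  have "full_access K s (Suc T)"
    using identified_imp_reachable_at[OF assms(1-3,5)]
    by (simp add: full_access_iff[OF \<rho>] reachable_at_iff[OF \<rho>])
  then show ?thesis
    by (intro exI[of _ "Suc T"]) simp
qed

end
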